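(* Let $A$, $B$ and $Y$ be $k$-spaces, with $B$ weak Hausdorff, and let $q:Y\to B$ be a Hurewicz fibration. If $A\to B$ is a closed cofibration, then $Y|A\to Y$ is also a closed cofibration.
   Context: A topological space $X$ is a $k$-space if it has the final topology relative to all continuous maps $C\to X$ from compact Hausdorff spaces $C$; $kX$ denotes the set $X$ retopologized with this final topology. All spaces are $k$-spaces and all constructions are $k$-ified: $X\times Y$ means $k$ of the usual product, and pullbacks and subspaces carry the $k$-ification of the usual topology. $B$ is weak Hausdorff if its diagonal is closed in the ($k$-ified) product $B\times B$. A Hurewicz fibration is a map of $k$-spaces with the covering homotopy property relative to all $k$-spaces. A closed cofibration is the inclusion of a closed subspace having the homotopy extension property with respect to all ($k$-)spaces. $Y|A=q^{-1}(A)\subseteq Y$, with inclusion $Y|A\to Y$. *)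

theory Defs
  imports "HOL-Analysis.Analysis"
begin

text \<open>
  HOL cannot quantify over the spaces carried by all types, so each notion below that quantifies
  over all compact Hausdorff spaces, or over all k-spaces, quantifies over those carried by one type
  that is large enough.  That nothing is lost by this is proved here: see the lemmas
  \<open>openin_kify_test\<close>, \<open>closed_cofibration_extend\<close> and \<open>hurewicz_fibration_lift\<close>, whose test
  spaces are carried by an arbitrary type.

  The library constant \<open>k_space\<close> is a different notion (it tests on compact subsets that need
  not be Hausdorff), hence the separate names.
\<close>

definition kify_open :: "'a topology \<Rightarrow> 'a set \<Rightarrow> bool" where
  "kify_open X U \<longleftrightarrow> U \<subseteq> topspace X \<and>
     (\<forall>(C :: ((nat \<times> 'a) set \<Rightarrow> bool) topology) f.
        compact_space C \<and> Hausdorff_space C \<and> continuous_map C X f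
        \<longrightarrow> openin C {c \<in> topspace C. f c \<in> U})"

definition kify :: "'a topology \<Rightarrow> 'a topology" where
  "kify X = topology (kify_open X)"

definition kspace :: "'a topology \<Rightarrow> bool" where
  "kspace X \<longleftrightarrow> kify X = X"

definition k_prod :: "'a topology \<Rightarrow> 'b topology \<Rightarrow> ('a \<times> 'b) topology" where
  "k_prod X Y = kify (prod_topology X Y)"

definition k_subspace :: "'a topology \<Rightarrow> 'a set \<Rightarrow> 'a topology" where
  "k_subspace X S = kify (subtopology X S)"

definition weak_Hausdorff :: "'a topology \<Rightarrow> bool" where
  "weak_Hausdorff X \<longleftrightarrow> closedin (k_prod X X) {(x, x) | x. x \<in> topspace X}"

abbreviation unit_interval :: "real topology" where
  "unit_interval \<equiv> top_of_set {0..1}"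

definition hurewicz_fibration :: "'y topology \<Rightarrow> 'b topology \<Rightarrow> ('y \<Rightarrow> 'b) \<Rightarrow> bool" where
  "hurewicz_fibration Y B q \<longleftrightarrow>
     kspace Y \<and> kspace B \<and> continuous_map Y B q \<and>
     (\<forall>(Z :: ('y \<times> (real \<Rightarrow> 'b)) topology) g h.
        kspace Z \<and> continuous_map Z Y g \<and> continuous_map (k_prod Z unit_interval) B h \<and>
        (\<forall>z \<in> topspace Z. h (z, 0) = q (g z))
        \<longrightarrow> (\<exists>H. continuous_map (k_prod Z unit_interval) Y H \<and>
                 (\<forall>z \<in> topspace Z. H (z, 0) = g z) \<and>
                 (\<forall>z \<in> topspace Z. \<forall>t \<in> {0..1}. q (H (z, t)) = h (z, t))))"

text \<open>
  \<open>closed_cofibration A X\<close> concerns the inclusion map of \<open>A\<close> into \<open>X\<close>.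
\<close>

definition closed_cofibration :: "'a topology \<Rightarrow> 'a topology \<Rightarrow> bool" where
  "closed_cofibration A X \<longleftrightarrow>
     kspace X \<and> closedin X (topspace A) \<and> A = k_subspace X (topspace A) \<and>
     (\<forall>(E :: ('a \<times> real) topology) f h.
        kspace E \<and> continuous_map X E f \<and> continuous_map (k_prod A unit_interval) E h \<and>
        (\<forall>a \<in> topspace A. h (a, 0) = f a)
        \<longrightarrow> (\<exists>H. continuous_map (k_prod X unit_interval) E H \<and>
                 (\<forall>x \<in> topspace X. H (x, 0) = f x) \<and>
                 (\<forall>a \<in> topspace A. \<forall>t \<in> {0..1}. H (a, t) = h (a, t))))"

definition restrict_over :: "'y topology \<Rightarrow> ('y \<Rightarrow> 'b) \<Rightarrow> 'b topology \<Rightarrow> 'y topology" where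
  "restrict_over Y q A = k_subspace Y {y \<in> topspace Y. q y \<in> topspace A}"


subsection \<open>The k-ification\<close>

lemma openin_kify: "openin (kify X) U \<longleftrightarrow> kify_open X U"
proof -
  have "istopology (kify_open X)"
    unfolding istopology_def
  proof (intro conjI allI impI)
    fix S T
    assume S: "kify_open X S" and T: "kify_open X T"
    have eq: "{c \<in> topspace C. f c \<in> S \<inter> T} = {c \<in> topspace C. f c \<in> S} \<inter> {c \<in> topspace C. f c \<in> T}"
      for C :: "((nat \<times> 'a) set \<Rightarrow> bool) topology" and f
      by blast
    show "kify_open X (S \<inter> T)"
      using S T unfolding kify_open_def eq by (auto intro!: openin_Int)
  next
    fix \<K>
    assume K: "\<forall>K\<in>\<K>. kify_open X K"
    have eq: "{c \<in> topspace C. f c \<in> \<Union>\<K>} = \<Union>((\<lambda>K. {c \<in> topspace C. f c \<in> K}) ` \<K>)"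
      for C :: "((nat \<times> 'a) set \<Rightarrow> bool) topology" and f
      by blast
    show "kify_open X (\<Union>\<K>)"
      using K unfolding kify_open_def eq by (auto intro!: openin_Union)
  qed
  then show ?thesis
    by (simp add: kify_def topology_inverse')
qed

lemma openin_imp_openin_kify: "openin X U \<Longrightarrow> openin (kify X) U"
  unfolding openin_kify kify_open_def
  by (auto dest: openin_subset intro: openin_continuous_map_preimage)

lemma topspace_kify [simp]: "topspace (kify X) = topspace X"
proof
  show "topspace (kify X) \<subseteq> topspace X"
    using openin_topspace [of "kify X"] unfolding openin_kify kify_open_def by blast
  show "topspace X \<subseteq> topspace (kify X)"
    by (simp add: openin_imp_openin_kify openin_subset)
qed

text \<open>
  A family of sets that contains a given set and is closed under countably many binary operations,
  each depending on two further parameters in \<open>'a set\<close>, can be indexed by \<open>(nat \<times> 'a) set\<close>.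
\<close>

datatype 'a kterm = KLeaf | KNode nat "'a set" "'a set" "'a kterm" "'a kterm"

primrec kterm_code :: "'a kterm \<Rightarrow> (nat \<times> 'a) set" where
  "kterm_code KLeaf = {}"
| "kterm_code (KNode n V W s t) =
     {(prod_encode (0, n), undefined)} \<union> Pair (prod_encode (1, 0)) ` V \<union>
     Pair (prod_encode (2, 0)) ` W \<union>
     (\<lambda>(k, a). (prod_encode (3, k), a)) ` kterm_code s \<union>
     (\<lambda>(k, a). (prod_encode (4, k), a)) ` kterm_code t"

primrec kterm_val :: "'c \<Rightarrow> (nat \<Rightarrow> 'a set \<Rightarrow> 'a set \<Rightarrow> 'c \<Rightarrow> 'c \<Rightarrow> 'c) \<Rightarrow> 'a kterm \<Rightarrow> 'c" where
  "kterm_val b g KLeaf = b"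
| "kterm_val b g (KNode n V W s t) = g n V W (kterm_val b g s) (kterm_val b g t)"

lemma kterm_code_inject: "kterm_code s = kterm_code t \<Longrightarrow> s = t"
proof (induction s arbitrary: t)
  case KLeaf
  then show ?case
    by (cases t) auto
next
  case (KNode n V W s1 s2)
  then obtain n' V' W' t1 t2 where t: "t = KNode n' V' W' t1 t2"
    by (cases t) auto
  have slot: "(x \<in> kterm_code (KNode n V W s1 s2)) = (x \<in> kterm_code (KNode n' V' W' t1 t2))" for x
    using KNode.prems t by simp
  have "n = n'"
    using slot [of "(prod_encode (0, n), undefined)"] by (auto simp: image_iff split_beta)
  moreover have "V = V'"
    using slot [of "(prod_encode (1, 0), v)" for v] by (auto simp: image_iff split_beta)
  moreover have "W = W'"
    using slot [of "(prod_encode (2, 0), v)" for v] by (auto simp: image_iff split_beta)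
  moreover have "(k, a) \<in> kterm_code s1 \<longleftrightarrow> (k, a) \<in> kterm_code t1" for k a
    using slot [of "(prod_encode (3, k), a)"] by (force simp: image_iff)
  then have "s1 = t1"
    by (intro KNode.IH) auto
  moreover have "(k, a) \<in> kterm_code s2 \<longleftrightarrow> (k, a) \<in> kterm_code t2" for k a
    using slot [of "(prod_encode (4, k), a)"] by (force simp: image_iff)
  then have "s2 = t2"
    by (intro KNode.IH) auto
  ultimately show ?case
    using t by simp
qed

lemma indexed_closure:
  fixes g :: "nat \<Rightarrow> 'a set \<Rightarrow> 'a set \<Rightarrow> 'c \<Rightarrow> 'c \<Rightarrow> 'c" and b :: 'c
  obtains m :: "(nat \<times> 'a) set \<Rightarrow> 'c"
    where "\<exists>i. m i = b" "\<And>n V W i j. \<exists>k. m k = g n V W (m i) (m j)"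
      "\<And>i. m i = b \<or> (\<exists>n V W c d. m i = g n V W c d)"
proof
  define m where "m \<equiv> \<lambda>i. kterm_val b g (inv kterm_code i)"
  have m: "m (kterm_code t) = kterm_val b g t" for t
    unfolding m_def using kterm_code_inject by (metis f_inv_into_f rangeI)
  show "\<exists>i. m i = b"
    using m [of KLeaf] by auto
  show "\<exists>k. m k = g n V W (m i) (m j)" for n V W i j
    using m [of "KNode n V W (inv kterm_code i) (inv kterm_code j)"] by (auto simp: m_def)
  show "m i = b \<or> (\<exists>n V W c d. m i = g n V W c d)" for i
    unfolding m_def by (cases "inv kterm_code i") (simp, fastforce)
qed

lemma closure_of_split:
  assumes C: "compact_space C" "Hausdorff_space C" and b: "b \<subseteq> topspace C"
    and "openin C V" "openin C W" and sub: "C closure_of b \<subseteq> V \<union> W"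
  obtains b1 b2 where "b = b1 \<union> b2" "C closure_of b1 \<subseteq> V" "C closure_of b2 \<subseteq> W"
proof -
  have "normal_space C"
    using C by (simp add: compact_Hausdorff_or_regular_imp_normal_space)
  moreover have "closedin C (C closure_of b - W)" "closedin C (C closure_of b - V)"
    using assms by (auto intro: closedin_diff)
  moreover have "disjnt (C closure_of b - W) (C closure_of b - V)"
    using sub by (auto simp: disjnt_iff)
  ultimately obtain O1 O2 where O: "openin C O1" "openin C O2" "C closure_of b - W \<subseteq> O1"
      "C closure_of b - V \<subseteq> O2" "disjnt O1 O2"
    unfolding normal_space_def by meson
  have "C closure_of (b - O2) \<subseteq> C closure_of b"
    by (simp add: closure_of_mono)
  moreover have "C closure_of (b - O2) \<subseteq> topspace C - O2"
    using O b by (intro closure_of_minimal) auto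
  ultimately have 1: "C closure_of (b - O2) \<subseteq> V"
    using O by blast
  have "C closure_of (b \<inter> O2) \<subseteq> C closure_of b"
    by (simp add: closure_of_mono)
  moreover have "C closure_of (b \<inter> O2) \<subseteq> topspace C - O1"
    using O b by (intro closure_of_minimal) (auto simp: disjnt_iff)
  ultimately have 2: "C closure_of (b \<inter> O2) \<subseteq> W"
    using O by blast
  show thesis
    by (rule that [OF _ 1 2]) blast
qed

lemma closure_of_meets: "x \<in> X closure_of S \<Longrightarrow> openin X T \<Longrightarrow> x \<in> T \<Longrightarrow> \<exists>y\<in>S. y \<in> T"
  by (auto simp: in_closure_of)

lemma compact_space_fipD:
  assumes "compact_space X" "\<And>T. T \<in> \<U> \<Longrightarrow> closedin X T"
    and "\<And>\<F>. finite \<F> \<Longrightarrow> \<F> \<subseteq> \<U> \<Longrightarrow> \<Inter>\<F> \<noteq> {}"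
  shows "\<Inter>\<U> \<noteq> {}"
  using assms unfolding compact_space_fip by blast

text \<open>
  If \<open>f\<close> witnessed that \<open>U\<close> fails to be open, then so would a map from a compact space \<open>S\<close> of
  bounded size: \<open>S\<close> is the Stone space of a small algebra of subsets of \<open>f\<^sup>-\<^sup>1(X - U)\<close>.
\<close>

lemma openin_kify_test:
  fixes X :: "'a topology" and C :: "'c topology"
  assumes U: "openin (kify X) U"
    and C: "compact_space C" "Hausdorff_space C" and f: "continuous_map C X f"
  shows "openin C {c \<in> topspace C. f c \<in> U}"
proof (rule ccontr)
  assume nopen: "\<not> openin C {c \<in> topspace C. f c \<in> U}"
  define D where "D = {c \<in> topspace C. f c \<notin> U}"
  have DC: "D \<subseteq> topspace C"
    by (auto simp: D_def)
  have "topspace C - D = {c \<in> topspace C. f c \<in> U}"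
    by (auto simp: D_def)
  then have "\<not> closedin C D"
    using nopen DC by (simp add: closedin_def)
  then have "\<not> C closure_of D \<subseteq> D"
    using DC closure_of_subset_eq by blast
  then obtain p where pcl: "p \<in> C closure_of D" and "p \<notin> D"
    by blast
  then have pC: "p \<in> topspace C" and fpU: "f p \<in> U"
    by (auto simp: D_def in_closure_of)
  define pre where "pre V = {c \<in> topspace C. f c \<in> V}" for V
  have open_pre: "openin C (pre V)" if "openin X V" for V
    using that f unfolding pre_def by (rule openin_continuous_map_preimage [rotated])
  have "\<exists>M. openin X V \<and> f p \<in> V \<longrightarrow> C closure_of (D \<inter> M) \<subseteq> pre V \<and> p \<notin> C closure_of (D - M)" for V
  proof (cases "openin X V \<and> f p \<in> V")
    case True
    have "regular_space C"
      using C by (rule compact_Hausdorff_imp_regular_space)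
    then have "neighbourhood_base_of (closedin C) C"
      by (simp add: neighbourhood_base_of_closedin)
    moreover have "openin C (pre V)" "p \<in> pre V"
      using True open_pre pC by (auto simp: pre_def)
    ultimately obtain O1 K where OK: "openin C O1" "closedin C K" "p \<in> O1" "O1 \<subseteq> K" "K \<subseteq> pre V"
      unfolding neighbourhood_base_of by meson
    have "C closure_of (D \<inter> K) \<subseteq> K"
      using OK by (intro closure_of_minimal) auto
    moreover have "C closure_of (D - K) \<subseteq> topspace C - O1"
      using OK DC by (intro closure_of_minimal) auto
    ultimately show ?thesis
      using OK by blast
  qed auto
  then obtain M where M: "\<And>V. openin X V \<Longrightarrow> f p \<in> V \<Longrightarrow>
      C closure_of (D \<inter> M V) \<subseteq> pre V \<and> p \<notin> C closure_of (D - M V)"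
    by metis
  define spl where "spl V W b = (SOME x. b = fst x \<union> snd x \<and>
      C closure_of fst x \<subseteq> pre V \<and> C closure_of snd x \<subseteq> pre W)" for V W b
  define s1 where "s1 V W b = fst (spl V W b)" for V W b
  define s2 where "s2 V W b = snd (spl V W b)" for V W b
  have s: "b = s1 V W b \<union> s2 V W b \<and> C closure_of s1 V W b \<subseteq> pre V \<and> C closure_of s2 V W b \<subseteq> pre W"
    if prems: "b \<subseteq> D" "openin X V" "openin X W" "C closure_of b \<subseteq> pre V \<union> pre W" for V W b
  proof -
    have "b \<subseteq> topspace C"
      using prems DC by blast
    then obtain b1 b2 where "b = b1 \<union> b2" "C closure_of b1 \<subseteq> pre V" "C closure_of b2 \<subseteq> pre W"
      by (rule closure_of_split [OF C _ open_pre open_pre]) (rule prems)+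
    then have "\<exists>x. b = fst x \<union> snd x \<and> C closure_of fst x \<subseteq> pre V \<and> C closure_of snd x \<subseteq> pre W"
      by (intro exI [of _ "(b1, b2)"]) simp
    from someI_ex [OF this] show ?thesis
      unfolding s1_def s2_def spl_def .
  qed
  define g :: "nat \<Rightarrow> 'a set \<Rightarrow> 'a set \<Rightarrow> 'c set \<Rightarrow> 'c set \<Rightarrow> 'c set" where
    "g n V W b c = D \<inter> (if n = 0 then M V else if n = 1 then - b else if n = 2 then b \<inter> c
        else if n = 3 then {SOME d. d \<in> b} else if n = 4 then s1 V W b else s2 V W b)" for n V W b c
  obtain m :: "(nat \<times> 'a) set \<Rightarrow> 'c set" where mfull: "\<exists>i. m i = D"
    and mg: "\<And>n V W i j. \<exists>k. m k = g n V W (m i) (m j)"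
    and mrange: "\<And>i. m i = D \<or> (\<exists>n V W c d. m i = g n V W c d)"
    using indexed_closure [of D g] by metis
  have mD: "m i \<subseteq> D" for i
    using mrange [of i] by (auto simp: g_def)
  have mbase: "\<exists>k. m k = D \<inter> M V" for V
    using mg [of 0 V] by (simp add: g_def)
  have mcompl: "\<exists>k. m k = D - m i" for i
    using mg [of 1 _ _ i] by (simp add: g_def Diff_eq)
  have mint: "\<exists>k. m k = m i \<inter> m j" for i j
    using mg [of 2 _ _ i j] mD [of i] by (simp add: g_def) (metis Int_assoc inf.absorb_iff2)
  have mpick: "\<exists>k d. d \<in> m i \<and> m k = {d}" if "m i \<noteq> {}" for i
  proof -
    have "(SOME d. d \<in> m i) \<in> m i"
      using that by (simp add: some_in_eq)
    then show ?thesis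
      using mg [of 3 _ _ i] mD [of i] by (fastforce simp: g_def)
  qed
  have msplit: "\<exists>j k. m i = m j \<union> m k \<and> C closure_of m j \<subseteq> pre V \<and> C closure_of m k \<subseteq> pre W"
    if "openin X V" "openin X W" "C closure_of m i \<subseteq> pre V \<union> pre W" for i V W
  proof -
    have 1: "m i = s1 V W (m i) \<union> s2 V W (m i)" "C closure_of s1 V W (m i) \<subseteq> pre V"
      "C closure_of s2 V W (m i) \<subseteq> pre W"
      using s [OF mD that] by auto
    then have "s1 V W (m i) \<subseteq> D" "s2 V W (m i) \<subseteq> D"
      using mD [of i] by blast+
    then obtain j k where "m j = s1 V W (m i)" "m k = s2 V W (m i)"
      using mg [of 4 V W i i] mg [of 5 V W i i] by (auto simp: g_def inf.absorb2)
    with 1 show ?thesis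
      by metis
  qed
  define P where "P = product_topology (\<lambda>i. discrete_topology (UNIV::bool set)) (UNIV :: (nat \<times> 'a) set set)"
  have topP [simp]: "topspace P = UNIV"
    by (simp add: P_def)
  define pt where "pt d = (\<lambda>i. d \<in> m i)" for d
  define S where "S = subtopology P (P closure_of (pt ` D))"
  have topS: "topspace S = P closure_of (pt ` D)"
    by (simp add: S_def)
  have S: "compact_space S" "Hausdorff_space S"
  proof -
    have "compact_space P"
      by (simp add: P_def compact_space_product_topology compact_space_discrete_topology)
    then show "compact_space S"
      unfolding S_def by (simp add: closedin_compact_space compact_space_subtopology)
    show "Hausdorff_space S"
      unfolding S_def P_def by (simp add: Hausdorff_space_product_topology Hausdorff_space_subtopology)
  qed
  have cylP: "openin P {r. r i = v}" for i v
  proof -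
    have "continuous_map P (discrete_topology UNIV) (\<lambda>r. r i)"
      unfolding P_def by (rule continuous_map_product_projection [of i UNIV "\<lambda>i. discrete_topology UNIV", simplified])
    from openin_continuous_map_preimage [OF this, of "{v}"] show ?thesis
      by simp
  qed
  have ptS: "pt d \<in> topspace S" if "d \<in> D" for d
    using that closure_of_subset [of "pt ` D" P] by (auto simp: topS)
  have approx: "\<exists>d\<in>D. \<forall>i\<in>F. r i = (d \<in> m i)" if r: "r \<in> topspace S" and "finite F" for r F
  proof -
    have "openin P {r'. \<forall>i\<in>F. r' i = r i}"
      using \<open>finite F\<close>
    proof induction
      case empty
      show ?case
        using openin_topspace [of P] by simp
    next
      case (insert i F)
      have "{r'. \<forall>i\<in>insert i F. r' i = r i} = {r'. r' i = r i} \<inter> {r'. \<forall>i\<in>F. r' i = r i}"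
        by auto
      then show ?case
        using openin_Int [OF cylP insert.IH] by simp
    qed
    then obtain r' where "r' \<in> pt ` D" "\<forall>i\<in>F. r' i = r i"
      using closure_of_meets [OF r [unfolded topS]] by fastforce
    then show ?thesis
      by (auto simp: pt_def)
  qed
  have cylS: "openin S {r \<in> topspace S. r i = v}" for i v
    using cylP [of i v] unfolding S_def openin_subtopology by auto
  define K where "K r = {c \<in> topspace C. \<forall>i. r i \<longrightarrow> c \<in> C closure_of m i}" for r
  have shrink: "\<exists>i. r i \<and> C closure_of m i \<subseteq> V"
    if r: "r \<in> topspace S" and V: "openin C V" and KV: "K r \<subseteq> V" for r V
  proof -
    define \<U> where "\<U> = insert (topspace C - V) ((\<lambda>i. C closure_of m i) ` {i. r i})"
    have "\<Inter>\<U> = {}"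
    proof -
      obtain i where "m i = D"
        using mfull by blast
      then have "r i"
        using approx [OF r, of "{i}"] by auto
      moreover have "C closure_of m i \<subseteq> topspace C"
        by (rule closure_of_subset_topspace)
      ultimately show ?thesis
        using KV by (auto simp: \<U>_def K_def)
    qed
    moreover have "\<forall>T\<in>\<U>. closedin C T"
      using V by (auto simp: \<U>_def)
    ultimately obtain \<F> where \<F>: "finite \<F>" "\<F> \<subseteq> \<U>" "\<Inter>\<F> = {}"
      using compact_space_fipD [OF C(1), of \<U>] by blast
    then have "\<F> - {topspace C - V} \<subseteq> (\<lambda>i. C closure_of m i) ` {i. r i}"
      by (auto simp: \<U>_def)
    then obtain F where F: "F \<subseteq> {i. r i}" "finite F"
        "\<F> - {topspace C - V} = (\<lambda>i. C closure_of m i) ` F"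
      using finite_subset_image \<F>(1) by (metis finite_Diff)
    have "\<exists>k. r k \<and> m k \<subseteq> (\<Inter>i\<in>F. m i)"
      using F(2,1)
    proof (induction F)
      case empty
      obtain i where "m i = D"
        using mfull by blast
      then have "r i"
        using approx [OF r, of "{i}"] by auto
      then show ?case
        by auto
    next
      case (insert i F)
      then obtain k where k: "r k" "m k \<subseteq> (\<Inter>i\<in>F. m i)"
        by auto
      obtain l where l: "m l = m i \<inter> m k"
        using mint by blast
      have "r l"
        using approx [OF r, of "{i, k, l}"] k insert.prems l by auto
      then show ?case
        using k l by auto
    qed
    then obtain k where k: "r k" "m k \<subseteq> (\<Inter>i\<in>F. m i)"
      by blast
    have "C closure_of m k \<subseteq> V"
    proof
      fix c
      assume c: "c \<in> C closure_of m k"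
      then have "c \<in> C closure_of m i" if "i \<in> F" for i
        using k that closure_of_mono [of "m k" "m i" C] by blast
      then have "c \<in> T" if "T \<in> \<F>" "T \<noteq> topspace C - V" for T
        using that F(3) by blast
      moreover have "c \<in> topspace C"
        using c closure_of_subset_topspace by fastforce
      ultimately show "c \<in> V"
        using \<F>(3) by blast
    qed
    with k show ?thesis
      by blast
  qed
  have cover: "\<exists>V\<in>\<V>. \<exists>j. r j \<and> C closure_of m j \<subseteq> pre V"
    if r: "r \<in> topspace S" and "finite \<V>" "r i" "C closure_of m i \<subseteq> (\<Union>V\<in>\<V>. pre V)"
      "\<forall>V\<in>\<V>. openin X V" for r i \<V>
    using that(2-)
  proof (induction \<V> arbitrary: i)
    case empty
    obtain d where "d \<in> D" "d \<in> m i"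
      using approx [OF r, of "{i}"] empty.prems by auto
    then show ?case
      using empty.prems closure_of_subset [of "m i" C] mD [of i] DC by auto
  next
    case (insert V \<V>)
    have un: "(\<Union>V\<in>\<V>. pre V) = pre (\<Union>\<V>)"
      by (auto simp: pre_def)
    have "openin X (\<Union>\<V>)"
      using insert.prems by auto
    then obtain j k where jk: "m i = m j \<union> m k" "C closure_of m j \<subseteq> pre V"
        "C closure_of m k \<subseteq> pre (\<Union>\<V>)"
      using msplit [of V "\<Union>\<V>" i] insert.prems un by auto
    then have "r j \<or> r k"
      using approx [OF r, of "{i, j, k}"] insert.prems by auto
    then show ?case
    proof
      assume "r k"
      then show ?thesis
        using insert.IH [of k] insert.prems jk un by auto
    qed (use jk in auto)
  qed
  define good where "good r c \<longleftrightarrow> c \<in> K r \<and> (\<forall>V. openin X V \<and> f c \<in> V \<longrightarrow> K r \<subseteq> pre V)" for r c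
  have ex_good: "\<exists>c. good r c" if r: "r \<in> topspace S" for r
  proof (rule ccontr)
    assume "\<nexists>c. good r c"
    then have "\<forall>c\<in>K r. \<exists>V. openin X V \<and> f c \<in> V \<and> \<not> K r \<subseteq> pre V"
      by (auto simp: good_def)
    then obtain V where V: "\<And>c. c \<in> K r \<Longrightarrow> openin X (V c) \<and> f c \<in> V c \<and> \<not> K r \<subseteq> pre (V c)"
      by metis
    have "K r \<subseteq> pre (\<Union>c\<in>K r. V c)"
      using V by (auto simp: pre_def K_def)
    moreover have "openin C (pre (\<Union>c\<in>K r. V c))"
      using V by (intro open_pre) auto
    ultimately obtain i where i: "r i" "C closure_of m i \<subseteq> pre (\<Union>c\<in>K r. V c)"
      using shrink [OF r] by blast
    have "compactin C (C closure_of m i)"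
      using C(1) by (simp add: closedin_compact_space)
    moreover have "\<forall>T \<in> (\<lambda>c. pre (V c)) ` K r. openin C T"
      using V open_pre by auto
    moreover have "C closure_of m i \<subseteq> \<Union>((\<lambda>c. pre (V c)) ` K r)"
      using i by (auto simp: pre_def)
    ultimately obtain \<F> where "finite \<F>" "\<F> \<subseteq> (\<lambda>c. pre (V c)) ` K r" "C closure_of m i \<subseteq> \<Union>\<F>"
      unfolding compactin_def by metis
    then obtain F where F: "finite F" "F \<subseteq> K r" "C closure_of m i \<subseteq> (\<Union>c\<in>F. pre (V c))"
      by (metis finite_subset_image)
    then obtain c j where "c \<in> F" "r j" "C closure_of m j \<subseteq> pre (V c)"
      using cover [OF r, of "V ` F" i] i V by (auto simp: subset_iff)
    then have "K r \<subseteq> pre (V c)"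
      by (auto simp: K_def)
    then show False
      using V \<open>c \<in> F\<close> F by blast
  qed
  obtain q where q: "q \<in> topspace S" "\<And>i. q i \<Longrightarrow> p \<in> C closure_of m i"
  proof -
    define \<U> where "\<U> = (\<lambda>i. {r \<in> topspace S. r i = False}) ` {i. p \<notin> C closure_of m i}"
    have clo: "closedin S T" if T: "T \<in> \<U>" for T
    proof -
      obtain i where "T = {r \<in> topspace S. r i = False}"
        using T by (auto simp: \<U>_def)
      moreover have "{r \<in> topspace S. r i = False} = topspace S - {r \<in> topspace S. r i = True}"
        by auto
      ultimately show ?thesis
        using cylS [of i True] by auto
    qed
    have fip: "\<Inter>\<F> \<noteq> {}" if "finite \<F>" "\<F> \<subseteq> \<U>" for \<F>
    proof -
      obtain F where F: "F \<subseteq> {i. p \<notin> C closure_of m i}" "finite F"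
          "\<F> = (\<lambda>i. {r \<in> topspace S. r i = False}) ` F"
        using \<open>\<F> \<subseteq> \<U>\<close> \<open>finite \<F>\<close> unfolding \<U>_def by (meson finite_subset_image)
      have "closedin C (\<Union>i\<in>F. C closure_of m i)"
        using F by (intro closedin_Union) auto
      then have "openin C (topspace C - (\<Union>i\<in>F. C closure_of m i))"
        by auto
      moreover have "p \<in> topspace C - (\<Union>i\<in>F. C closure_of m i)"
        using F pC by auto
      ultimately obtain d where d: "d \<in> D" "d \<notin> (\<Union>i\<in>F. C closure_of m i)"
        using closure_of_meets [OF pcl] by blast
      have "d \<notin> m i" if "i \<in> F" for i
        using d that closure_of_subset [of "m i" C] mD [of i] DC by auto
      then have "pt d \<in> \<Inter>\<F>"
        using ptS [OF d(1)] F by (auto simp: pt_def)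
      then show ?thesis
        by blast
    qed
    have "\<Inter>\<U> \<noteq> {}"
      using clo fip by (rule compact_space_fipD [OF S(1)])
    then obtain q where q: "q \<in> \<Inter>\<U>"
      by blast
    obtain r where "r \<in> topspace S"
      using ptS pcl by (fastforce simp: in_closure_of)
    show thesis
    proof (cases "\<U> = {}")
      case True
      then show ?thesis
        using that [of r] \<open>r \<in> topspace S\<close> by (auto simp: \<U>_def)
    next
      case False
      then show ?thesis
        using that [of q] q by (auto simp: \<U>_def)
    qed
  qed
  have good_q: "good q p"
    unfolding good_def
  proof (intro conjI allI impI)
    show "p \<in> K q"
      using q pC by (auto simp: K_def)
    fix V
    assume V: "openin X V \<and> f p \<in> V"
    obtain i where i: "m i = D \<inter> M V"
      using mbase by blast
    obtain j where j: "m j = D - m i"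
      using mcompl by blast
    have "m j = D - M V"
      using i j by auto
    then have "\<not> q j"
      using M [of V] V q(2) [of j] by auto
    then have "q i"
      using approx [OF q(1), of "{i, j}"] j by auto
    then have "K q \<subseteq> C closure_of m i"
      by (auto simp: K_def)
    then show "K q \<subseteq> pre V"
      using M [of V] V i by auto
  qed
  define f' where "f' r = f (if r = q then p else SOME c. good r c)" for r
  have f': "\<exists>c. f' r = f c \<and> good r c" if "r \<in> topspace S" for r
    using good_q someI_ex [OF ex_good [OF that]] by (auto simp: f'_def)
  have "continuous_map S X f'"
    unfolding continuous_map_def
  proof (intro conjI allI impI funcsetI)
    show "f' r \<in> topspace X" if "r \<in> topspace S" for r
      using f' [OF that] f by (auto simp: good_def K_def continuous_map_def)
    fix V
    assume V: "openin X V"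
    show "openin S {r \<in> topspace S. f' r \<in> V}"
    proof (subst openin_subopen, clarify)
      fix r
      assume r: "r \<in> topspace S" "f' r \<in> V"
      then obtain c where "f' r = f c" "good r c"
        using f' by blast
      then have "K r \<subseteq> pre V"
        using r V by (auto simp: good_def)
      then obtain i where i: "r i" "C closure_of m i \<subseteq> pre V"
        using shrink [OF r(1) open_pre [OF V]] by blast
      have "f' r' \<in> V" if r': "r' \<in> topspace S" "r' i" for r'
      proof -
        obtain c' where c': "f' r' = f c'" "c' \<in> K r'"
          using f' [OF r'(1)] by (auto simp: good_def)
        then have "c' \<in> C closure_of m i"
          using r' by (simp add: K_def)
        then have "c' \<in> pre V"
          using i by blast
        then show ?thesis
          by (simp add: pre_def c')
      qed
      then have "{r' \<in> topspace S. r' i = True} \<subseteq> {r \<in> topspace S. f' r \<in> V}"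
        by auto
      then show "\<exists>T. openin S T \<and> r \<in> T \<and> T \<subseteq> {r \<in> topspace S. f' r \<in> V}"
        using cylS [of i True] r i by blast
    qed
  qed
  then have "openin S {r \<in> topspace S. f' r \<in> U}"
    using U S unfolding openin_kify kify_open_def by blast
  then obtain T where T: "openin P T" "{r \<in> topspace S. f' r \<in> U} = T \<inter> P closure_of (pt ` D)"
    unfolding S_def openin_subtopology by blast
  moreover have "f' q \<in> U"
    using fpU by (simp add: f'_def)
  ultimately have "q \<in> T"
    using q by auto
  then obtain W where W: "finite {i. W i \<noteq> UNIV}" "q \<in> Pi\<^sub>E UNIV W" "Pi\<^sub>E UNIV W \<subseteq> T"
    using T(1) unfolding P_def openin_product_topology_alt by fastforce
  define F where "F = {i. W i \<noteq> UNIV}"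
  have inT: "r \<in> T" if "\<forall>i\<in>F. r i = q i" for r
  proof -
    have "r i \<in> W i" for i
      using W(2) that by (cases "i \<in> F") (auto simp: F_def)
    then show ?thesis
      using W(3) by auto
  qed
  have "\<exists>k. m k = {d \<in> D. \<forall>i\<in>F. q i = (d \<in> m i)}" if "finite F" for F
    using that
  proof induction
    case empty
    then show ?case
      using mfull by simp
  next
    case (insert i F)
    then obtain k where k: "m k = {d \<in> D. \<forall>i\<in>F. q i = (d \<in> m i)}"
      by blast
    obtain j where j: "m j = D - m i"
      using mcompl by blast
    have "{d \<in> D. \<forall>i\<in>insert i F. q i = (d \<in> m i)} = (if q i then m i else m j) \<inter> m k"
      using j k by auto
    then show ?case
      using mint by (metis (full_types))
  qed
  then obtain k where k: "m k = {d \<in> D. \<forall>i\<in>F. q i = (d \<in> m i)}"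
    using W(1) unfolding F_def by blast
  then have "m k \<noteq> {}"
    using approx [OF q(1), of F] W(1) by (auto simp: F_def)
  then obtain l d where d: "d \<in> m k" "m l = {d}"
    using mpick by blast
  then have dD: "d \<in> D"
    using mD by blast
  have "pt d \<in> T"
    using inT [of "pt d"] d k by (auto simp: pt_def)
  then have "f' (pt d) \<in> U"
    using T(2) ptS [OF dD] unfolding topS by blast
  moreover obtain c where c: "f' (pt d) = f c" "c \<in> K (pt d)"
    using f' [OF ptS [OF dD]] by (auto simp: good_def)
  have "pt d l"
    by (simp add: pt_def d)
  then have "c \<in> C closure_of {d}"
    using c(2) d(2) by (auto simp: K_def)
  moreover have "C closure_of {d} = {d}"
    using C(2) dD DC by (simp add: closure_of_eq closedin_Hausdorff_singleton subsetD)
  ultimately show False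
    using c dD by (auto simp: D_def)
qed

lemma continuous_map_into_kify_compact:
  assumes "compact_space C" "Hausdorff_space C" "continuous_map C X f"
  shows "continuous_map C (kify X) f"
  using assms openin_kify_test [OF _ assms] by (auto simp: continuous_map_def)

lemma continuous_map_from_kify:
  "continuous_map X Y f \<Longrightarrow> continuous_map (kify X) Y f"
  by (auto simp: continuous_map_def intro: openin_imp_openin_kify)

lemma openin_kify_iff:
  fixes X :: "'a topology"
  shows "openin (kify X) U \<longleftrightarrow> U \<subseteq> topspace X \<and>
     (\<forall>(C :: ((nat \<times> 'a) set \<Rightarrow> bool) topology) f.
        compact_space C \<and> Hausdorff_space C \<and> continuous_map C X f
        \<longrightarrow> openin C {c \<in> topspace C. f c \<in> U})"
  by (simp add: openin_kify kify_open_def)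

lemma kspace_kify [simp]: "kspace (kify X)"
proof -
  have "openin (kify (kify X)) U \<longleftrightarrow> openin (kify X) U" for U
  proof
    assume "openin (kify (kify X)) U"
    then show "openin (kify X) U"
      unfolding openin_kify_iff topspace_kify using continuous_map_into_kify_compact by blast
  qed (rule openin_imp_openin_kify)
  then show ?thesis
    unfolding kspace_def topology_eq by blast
qed

lemma kspaceI:
  fixes X :: "'a topology"
  assumes "\<And>U. U \<subseteq> topspace X \<Longrightarrow>
     (\<And>(C :: ((nat \<times> 'a) set \<Rightarrow> bool) topology) f.
        compact_space C \<Longrightarrow> Hausdorff_space C \<Longrightarrow> continuous_map C X f
        \<Longrightarrow> openin C {c \<in> topspace C. f c \<in> U}) \<Longrightarrow> openin X U"
  shows "kspace X"
proof -
  have "openin (kify X) U \<longleftrightarrow> openin X U" for U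
    using assms [of U] openin_imp_openin_kify [of X U] unfolding openin_kify_iff by blast
  then show ?thesis
    unfolding kspace_def topology_eq by blast
qed

lemma kspace_compact_Hausdorff:
  assumes "compact_space X" "Hausdorff_space X"
  shows "kspace X"
proof -
  have "openin X U" if "openin (kify X) U" for U
  proof -
    have "{x \<in> topspace X. id x \<in> U} = U"
      using openin_subset [OF that] by auto
    then show ?thesis
      using openin_kify_test [OF that assms continuous_map_id] by simp
  qed
  then show ?thesis
    unfolding kspace_def topology_eq using openin_imp_openin_kify by blast
qed

lemma continuous_map_kify_kify:
  assumes "continuous_map X Y f"
  shows "continuous_map (kify X) (kify Y) f"
  unfolding continuous_map_def
proof (intro conjI allI impI)
  show fim: "f \<in> topspace (kify X) \<rightarrow> topspace (kify Y)"
    using assms by (auto simp: continuous_map_def)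
  fix V
  assume V: "openin (kify Y) V"
  show "openin (kify X) {x \<in> topspace (kify X). f x \<in> V}"
    unfolding openin_kify_iff
  proof (intro conjI allI impI)
    fix C :: "((nat \<times> 'a) set \<Rightarrow> bool) topology" and g
    assume C: "compact_space C \<and> Hausdorff_space C \<and> continuous_map C X g"
    then have "continuous_map C Y (f \<circ> g)"
      using assms continuous_map_compose by blast
    then have "openin C {c \<in> topspace C. (f \<circ> g) c \<in> V}"
      using C openin_kify_test [OF V] by blast
    moreover have "{c \<in> topspace C. g c \<in> {x \<in> topspace (kify X). f x \<in> V}} = {c \<in> topspace C. (f \<circ> g) c \<in> V}"
      using C by (auto simp: continuous_map_def)
    ultimately show "openin C {c \<in> topspace C. g c \<in> {x \<in> topspace (kify X). f x \<in> V}}"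
      by simp
  qed auto
qed

lemma continuous_map_into_kify:
  assumes "kspace Z" "continuous_map Z X f"
  shows "continuous_map Z (kify X) f"
  using continuous_map_kify_kify [OF assms(2)] assms(1) by (simp add: kspace_def)

lemma topspace_k_prod [simp]: "topspace (k_prod X Y) = topspace X \<times> topspace Y"
  by (simp add: k_prod_def)

lemma topspace_k_subspace [simp]: "topspace (k_subspace X S) = topspace X \<inter> S"
  by (simp add: k_subspace_def)

lemma kspace_k_prod [simp]: "kspace (k_prod X Y)"
  by (simp add: k_prod_def)

lemma kspace_k_subspace [simp]: "kspace (k_subspace X S)"
  by (simp add: k_subspace_def)

lemma kspace_unit_interval: "kspace unit_interval"
  by (intro kspace_compact_Hausdorff)
    (auto simp: compact_space_subtopology Hausdorff_space_subtopology)

lemma continuous_map_k_prod_map: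
  assumes "continuous_map X X' f" "continuous_map Y Y' g"
  shows "continuous_map (k_prod X Y) (k_prod X' Y') (\<lambda>(x, y). (f x, g y))"
proof -
  have "continuous_map (prod_topology X Y) (prod_topology X' Y') (\<lambda>(x, y). (f x, g y))"
    using assms by (simp add: continuous_map_prod_top)
  then show ?thesis
    unfolding k_prod_def by (rule continuous_map_kify_kify)
qed

lemma kspace_prod_compact:
  assumes Z: "kspace Z" and J: "compact_space J" "Hausdorff_space J"
  shows "kspace (prod_topology Z J)"
proof -
  have "openin (prod_topology Z J) W" if W: "openin (kify (prod_topology Z J)) W" for W
    unfolding openin_prod_topology_alt
  proof (intro allI impI)
    fix z t
    assume zt: "(z, t) \<in> W"
    have WZJ: "W \<subseteq> topspace Z \<times> topspace J"
      using openin_subset [OF W] by simp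
    then have z: "z \<in> topspace Z" and t: "t \<in> topspace J"
      using zt by auto
    have "openin J {s \<in> topspace J. (z, s) \<in> W}"
      using z by (intro openin_kify_test [OF W J]) (simp add: continuous_map_pairwise o_def)
    moreover have "neighbourhood_base_of (closedin J) J"
      using J by (simp add: neighbourhood_base_of_closedin compact_Hausdorff_imp_regular_space)
    ultimately obtain V L where V: "openin J V" "closedin J L" "t \<in> V" "V \<subseteq> L"
        "L \<subseteq> {s \<in> topspace J. (z, s) \<in> W}"
      unfolding neighbourhood_base_of using zt t
      by (metis (no_types, lifting) mem_Collect_eq)
    have L: "compactin J L"
      using V J by (simp add: closedin_compact_space)
    define G where "G = {x \<in> topspace Z. {x} \<times> L \<subseteq> W}"
    have "openin (kify Z) G"
      unfolding openin_kify_iff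
    proof (intro conjI allI impI)
      fix C :: "((nat \<times> 'a) set \<Rightarrow> bool) topology" and g
      assume C: "compact_space C \<and> Hausdorff_space C \<and> continuous_map C Z g"
      define W' where "W' = {x \<in> topspace (prod_topology C J). (case x of (c, s) \<Rightarrow> (g c, s)) \<in> W}"
      have W': "openin (prod_topology C J) W'"
        unfolding W'_def
      proof (rule openin_kify_test [OF W])
        show "compact_space (prod_topology C J)" "Hausdorff_space (prod_topology C J)"
          using C J by (auto simp: compact_space_prod_topology Hausdorff_space_prod_topology)
        show "continuous_map (prod_topology C J) (prod_topology Z J) (\<lambda>(c, s). (g c, s))"
          using C by (simp add: continuous_map_prod_top)
      qed
      show "openin C {c \<in> topspace C. g c \<in> G}"
      proof (subst openin_subopen, clarify)
        fix c
        assume c: "c \<in> topspace C" "g c \<in> G"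
        have "{c} \<times> L \<subseteq> W'"
          using c V by (auto simp: W'_def G_def)
        then obtain O1 O2 where O: "openin C O1" "c \<in> O1" "L \<subseteq> O2" "O1 \<times> O2 \<subseteq> W'"
          using tube_lemma_right [OF W' L c(1)] by blast
        have "O1 \<subseteq> {c \<in> topspace C. g c \<in> G}"
        proof
          fix x
          assume x: "x \<in> O1"
          then have "x \<in> topspace C"
            using O openin_subset by blast
          then show "x \<in> {c \<in> topspace C. g c \<in> G}"
            using x O C by (fastforce simp: W'_def G_def continuous_map_def)
        qed
        then show "\<exists>T. openin C T \<and> c \<in> T \<and> T \<subseteq> {c \<in> topspace C. g c \<in> G}"
          using O by blast
      qed
    qed (auto simp: G_def)
    then have "openin Z G"
      using Z by (simp add: kspace_def)
    moreover have "z \<in> G"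
      using z V by (auto simp: G_def)
    moreover have "G \<times> V \<subseteq> W"
      using V by (auto simp: G_def)
    ultimately show "\<exists>U V. openin Z U \<and> openin J V \<and> z \<in> U \<and> t \<in> V \<and> U \<times> V \<subseteq> W"
      using V by blast
  qed
  then show ?thesis
    unfolding kspace_def topology_eq using openin_imp_openin_kify by blast
qed

lemma k_prod_unit_interval: "kspace Z \<Longrightarrow> k_prod Z unit_interval = prod_topology Z unit_interval"
  using kspace_prod_compact [of Z unit_interval]
  by (simp add: kspace_def k_prod_def compact_space_subtopology Hausdorff_space_subtopology)


subsection \<open>Test spaces carried by arbitrary types\<close>

lemma closed_cofibration_extend:
  fixes A X :: "'a topology" and E :: "'e topology"
  assumes "closed_cofibration A X" and "kspace E"
    and f: "continuous_map X E f" and h: "continuous_map (k_prod A unit_interval) E h"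
    and h0: "\<And>a. a \<in> topspace A \<Longrightarrow> h (a, 0) = f a"
  obtains H where "continuous_map (k_prod X unit_interval) E H"
    "\<And>x. x \<in> topspace X \<Longrightarrow> H (x, 0) = f x"
    "\<And>a t. a \<in> topspace A \<Longrightarrow> t \<in> {0..1} \<Longrightarrow> H (a, t) = h (a, t)"
proof -
  define r where "r = (\<lambda>(x, t :: real). if t < 0 then f x else h (x, t))"
  define j where "j = inv r"
  define N where "N = f ` topspace X \<union> h ` (topspace A \<times> {0..1})"
  have rj: "r (j e) = e" if "e \<in> N" for e
  proof -
    have "f x = r (x, -1)" for x
      by (simp add: r_def)
    moreover have "h (a, t) = r (a, t)" if "t \<in> {0..1}" for a t
      using that by (simp add: r_def)
    ultimately have "e \<in> range r"
      using that unfolding N_def by (auto simp: image_iff)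
    then show ?thesis
      by (simp add: j_def f_inv_into_f)
  qed
  define E' where "E' = pullback_topology (j ` N) r E"
  have N: "N \<subseteq> topspace E"
    using f h by (auto simp: N_def continuous_map_def)
  have r: "continuous_map E' E r"
    using continuous_map_pullback [OF continuous_map_id, of "j ` N" r E] by (simp add: E'_def)
  have lift: "continuous_map T (kify E') (j \<circ> k)"
    if "kspace T" "continuous_map T E k" "k ` topspace T \<subseteq> N" for T :: "'t topology" and k
  proof (rule continuous_map_into_kify [OF \<open>kspace T\<close>])
    have "continuous_map T E (r \<circ> (j \<circ> k))"
      using that(2) by (rule continuous_map_eq) (use that(3) rj in auto)
    then show "continuous_map T E' (j \<circ> k)"
      unfolding E'_def by (rule continuous_map_pullback') (use that(3) in auto)
  qed
  have X: "kspace X"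
    using assms(1) by (simp add: closed_cofibration_def)
  have "continuous_map X (kify E') (j \<circ> f)"
    using X f by (rule lift) (auto simp: N_def)
  moreover have "continuous_map (k_prod A unit_interval) (kify E') (j \<circ> h)"
    by (rule lift [OF kspace_k_prod h]) (auto simp: N_def)
  moreover have "\<forall>a\<in>topspace A. (j \<circ> h) (a, 0) = (j \<circ> f) a"
    using h0 by simp
  ultimately obtain H where H: "continuous_map (k_prod X unit_interval) (kify E') H"
      "\<forall>x\<in>topspace X. H (x, 0) = (j \<circ> f) x"
      "\<forall>a\<in>topspace A. \<forall>t\<in>{0..1}. H (a, t) = (j \<circ> h) (a, t)"
    using assms(1) [unfolded closed_cofibration_def, THEN conjunct2, THEN conjunct2, THEN conjunct2,
        THEN spec, THEN spec, THEN spec, of "kify E'" "j \<circ> f" "j \<circ> h"] by auto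
  show thesis
  proof (rule that)
    show "continuous_map (k_prod X unit_interval) E (r \<circ> H)"
      using H(1) continuous_map_from_kify [OF r] by (rule continuous_map_compose)
    show "(r \<circ> H) (x, 0) = f x" if "x \<in> topspace X" for x
      using that H(2) rj by (simp add: N_def)
    show "(r \<circ> H) (a, t) = h (a, t)" if "a \<in> topspace A" "t \<in> {0..1}" for a t
      using that H(3) rj by (simp add: N_def)
  qed
qed

lemma hurewicz_fibration_lift:
  fixes Y :: "'y topology" and B :: "'b topology" and Z :: "'z topology"
  assumes "hurewicz_fibration Y B q" and Z: "kspace Z"
    and g: "continuous_map Z Y g" and h: "continuous_map (k_prod Z unit_interval) B h"
    and h0: "\<And>z. z \<in> topspace Z \<Longrightarrow> h (z, 0) = q (g z)"
  obtains H where "continuous_map (k_prod Z unit_interval) Y H"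
    "\<And>z. z \<in> topspace Z \<Longrightarrow> H (z, 0) = g z"
    "\<And>z t. z \<in> topspace Z \<Longrightarrow> t \<in> {0..1} \<Longrightarrow> q (H (z, t)) = h (z, t)"
proof -
  define \<phi> where "\<phi> z = (g z, \<lambda>t. h (z, t))" for z
  define is_open where "is_open U \<longleftrightarrow> U \<subseteq> \<phi> ` topspace Z \<and> openin Z {z \<in> topspace Z. \<phi> z \<in> U}" for U
  define Z' where "Z' = topology is_open"
  have "istopology is_open"
    unfolding istopology_def
  proof (intro conjI allI impI)
    fix S T
    assume "is_open S" "is_open T"
    moreover have "{z \<in> topspace Z. \<phi> z \<in> S \<inter> T} = {z \<in> topspace Z. \<phi> z \<in> S} \<inter> {z \<in> topspace Z. \<phi> z \<in> T}"
      by blast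
    ultimately show "is_open (S \<inter> T)"
      by (auto simp: is_open_def)
  next
    fix \<K>
    assume K: "\<forall>K\<in>\<K>. is_open K"
    moreover have "{z \<in> topspace Z. \<phi> z \<in> \<Union>\<K>} = \<Union>((\<lambda>K. {z \<in> topspace Z. \<phi> z \<in> K}) ` \<K>)"
      by blast
    ultimately show "is_open (\<Union>\<K>)"
      by (auto simp: is_open_def)
  qed
  then have openZ': "openin Z' U \<longleftrightarrow> is_open U" for U
    by (simp add: Z'_def topology_inverse')
  have topZ': "topspace Z' = \<phi> ` topspace Z"
  proof
    show "topspace Z' \<subseteq> \<phi> ` topspace Z"
      using openin_topspace [of Z'] unfolding openZ' is_open_def by blast
    have "{z \<in> topspace Z. \<phi> z \<in> \<phi> ` topspace Z} = topspace Z"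
      by auto
    then show "\<phi> ` topspace Z \<subseteq> topspace Z'"
      by (intro openin_subset) (simp add: openZ' is_open_def)
  qed
  have quot: "quotient_map Z Z' \<phi>"
    unfolding quotient_map_def topZ' openZ' is_open_def by auto
  then have cont: "continuous_map Z Z' \<phi>"
    by (rule quotient_imp_continuous_map)
  have Z': "kspace Z'"
  proof -
    have "openin Z' U" if U: "openin (kify Z') U" for U
    proof -
      have "continuous_map Z (kify Z') \<phi>"
        using Z cont by (rule continuous_map_into_kify)
      then show ?thesis
        using U openin_subset [OF U] topZ' by (auto simp: openZ' is_open_def continuous_map_def)
    qed
    then show ?thesis
      unfolding kspace_def topology_eq using openin_imp_openin_kify by blast
  qed
  have quotI: "quotient_map (prod_topology Z unit_interval) (prod_topology Z' unit_interval) (\<lambda>(z, t). (\<phi> z, t))"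
    by (rule quotient_map_prod_left [OF _ _ quot])
      (auto simp: Hausdorff_space_subtopology compact_space_subtopology
        intro: compact_imp_locally_compact_space)
  define g' where "g' = (fst :: 'y \<times> (real \<Rightarrow> 'b) \<Rightarrow> 'y)"
  define h' where "h' = (\<lambda>((y :: 'y, \<gamma> :: real \<Rightarrow> 'b), t). \<gamma> t)"
  have "continuous_map Z Y (g' \<circ> \<phi>)"
    using g by (simp add: g'_def \<phi>_def o_def)
  then have "continuous_map Z' Y g'"
    using continuous_compose_quotient_map [OF quot] by blast
  moreover have "continuous_map (prod_topology Z unit_interval) B (h' \<circ> (\<lambda>(z, t). (\<phi> z, t)))"
    using h by (simp add: k_prod_unit_interval Z h'_def \<phi>_def o_def split_beta)
  then have "continuous_map (k_prod Z' unit_interval) B h'"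
    unfolding k_prod_unit_interval [OF Z'] using continuous_compose_quotient_map [OF quotI] by blast
  moreover have "\<forall>z\<in>topspace Z'. h' (z, 0) = q (g' z)"
    using h0 by (auto simp: topZ' h'_def g'_def \<phi>_def)
  ultimately obtain H where H: "continuous_map (k_prod Z' unit_interval) Y H"
      "\<forall>z\<in>topspace Z'. H (z, 0) = g' z"
      "\<forall>z\<in>topspace Z'. \<forall>t\<in>{0..1}. q (H (z, t)) = h' (z, t)"
    using assms(1) [unfolded hurewicz_fibration_def, THEN conjunct2, THEN conjunct2, THEN conjunct2,
        THEN spec, THEN spec, THEN spec, of Z' g' h'] Z' by auto
  show thesis
  proof (rule that)
    have "continuous_map (k_prod Z unit_interval) (k_prod Z' unit_interval) (\<lambda>(z, t). (\<phi> z, t))"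
      using cont by (intro continuous_map_k_prod_map) auto
    then show "continuous_map (k_prod Z unit_interval) Y (H \<circ> (\<lambda>(z, t). (\<phi> z, t)))"
      using H(1) by (rule continuous_map_compose)
    show "(H \<circ> (\<lambda>(z, t). (\<phi> z, t))) (z, 0) = g z" if "z \<in> topspace Z" for z
      using that H(2) by (simp add: topZ' g'_def \<phi>_def)
    show "q ((H \<circ> (\<lambda>(z, t). (\<phi> z, t))) (z, t)) = h (z, t)" if "z \<in> topspace Z" "t \<in> {0..1}" for z t
      using that H(3) by (simp add: topZ' h'_def \<phi>_def)
  qed
qed

end

theory Submission
  imports Defs
begin

text \<open>
  The inclusion of a closed subset \<open>S\<close> of \<open>X\<close> is a cofibration iff \<open>S\<close> is the zero set of a function
  \<open>u \<ge> 0\<close> for which some homotopy \<open>H\<close> of the identity of \<open>X\<close>, stationary on \<open>S\<close>, has moved each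
  \<open>x\<close> into \<open>S\<close> by the time \<open>u x\<close> (Strom).  Given such \<open>u\<close> and \<open>H\<close> for \<open>A\<close> in \<open>B\<close>, lift
  \<open>H \<circ> (q \<times> id)\<close> along \<open>q\<close> to a homotopy \<open>L\<close> of the identity of \<open>Y\<close> and stop it at time
  \<open>u (q y)\<close>.  The stopped homotopy is stationary over \<open>A\<close>, although \<open>L\<close> need not be, and together
  with \<open>u \<circ> q\<close> it exhibits \<open>Y|A\<close> as a cofibration in \<open>Y\<close>.
\<close>

section \<open>Closed subspaces of k-spaces, and suprema over a compact factor\<close>

text \<open>Closed subsets of compact Hausdorff spaces are compact Hausdorff, so restricting a test
  map into \<open>X\<close> to the preimage of \<open>S\<close> gives a test map into
  \<open>S\<close>. Hence the usual subspace topology on \<open>S\<close> needs no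
  k-ification.\<close>

lemma k_subspace_closedin:
  assumes X: "kspace X" and S: "closedin X S"
  shows "k_subspace X S = subtopology X S"
proof -
  have SX: "S \<subseteq> topspace X"
    using S closedin_subset by blast
  have "openin (subtopology X S) W" if W: "openin (kify (subtopology X S)) W" for W
  proof -
    have WS: "W \<subseteq> S"
      using openin_subset [OF W] by simp
    \<comment> \<open>The set tested in \<open>X\<close> is the largest one whose trace on
      \<open>S\<close> is \<open>W\<close>. Since \<open>S\<close> is closed, adding its complement
      costs nothing: outside \<open>D\<close> every point of \<open>C\<close> lies in the
      preimage.\<close>
    have "openin (kify X) (W \<union> (topspace X - S))"
      unfolding openin_kify_iff
    proof (intro conjI allI impI)
      fix C :: "((nat \<times> 'a) set \<Rightarrow> bool) topology" and f
      assume "compact_space C \<and> Hausdorff_space C \<and> continuous_map C X f"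
      then have C: "compact_space C" "Hausdorff_space C" and f: "continuous_map C X f"
        by auto
      define D where "D = {c \<in> topspace C. f c \<in> S}"
      have D: "closedin C D"
        unfolding D_def using f S by (rule closedin_continuous_map_preimage)
      have "compact_space (subtopology C D)" "Hausdorff_space (subtopology C D)"
        using C D by (auto simp: compact_space_subtopology closedin_compact_space
            Hausdorff_space_subtopology)
      moreover have "continuous_map (subtopology C D) (subtopology X S) f"
        using f by (auto simp: continuous_map_in_subtopology D_def intro: continuous_map_from_subtopology)
      ultimately have "openin (subtopology C D) {c \<in> topspace (subtopology C D). f c \<in> W}"
        using openin_kify_test [OF W] by blast
      then obtain O1 where O1: "openin C O1" "{c \<in> topspace (subtopology C D). f c \<in> W} = O1 \<inter> D"
        by (auto simp: openin_subtopology)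
      have "{c \<in> topspace C. f c \<in> W \<union> (topspace X - S)} = O1 \<union> (topspace C - D)"
        using O1 openin_subset [OF O1(1)] WS continuous_map_funspace [OF f]
        by (auto simp: D_def Pi_iff set_eq_iff)
      then show "openin C {c \<in> topspace C. f c \<in> W \<union> (topspace X - S)}"
        using O1 D by auto
    qed (use WS SX in auto)
    then have "openin X (W \<union> (topspace X - S))"
      using X by (simp add: kspace_def)
    moreover have "W = (W \<union> (topspace X - S)) \<inter> S"
      using WS by blast
    ultimately show ?thesis
      by (auto simp: openin_subtopology)
  qed
  then show ?thesis
    unfolding k_subspace_def topology_eq using openin_imp_openin_kify by blast
qed

text \<open>Lower semicontinuity holds because projections are open maps, upper semicontinuity by
  the tube lemma. Compactness of \<open>K\<close> also makes the supremum a maximum, which is what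
  keeps strict inequalities strict.\<close>

lemma continuous_map_Sup_compact:
  fixes g :: "'a \<times> 'c \<Rightarrow> real"
  assumes g: "continuous_map (prod_topology X K) euclideanreal g"
    and K: "compact_space K" "topspace K \<noteq> {}"
  shows "continuous_map X euclideanreal (\<lambda>x. SUP t\<in>topspace K. g (x, t))"
proof -
  define s where "s x = (SUP t\<in>topspace K. g (x, t))" for x
  have compact: "compact ((\<lambda>t. g (x, t)) ` topspace K)" if "x \<in> topspace X" for x
  proof -
    have "continuous_map K (prod_topology X K) (\<lambda>t. (x, t))"
      using that by (simp add: continuous_map_pairwise o_def)
    then have "continuous_map K euclideanreal (\<lambda>t. g (x, t))"
      using continuous_map_compose [OF _ g] by (fastforce simp: o_def)
    then show ?thesis
      using K image_compactin [of K "topspace K" euclideanreal "\<lambda>t. g (x, t)"]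
      by (simp add: compact_space_def)
  qed
  have upper: "g (x, t) \<le> s x" if "x \<in> topspace X" "t \<in> topspace K" for x t
    unfolding s_def using that compact [of x]
    by (auto intro!: cSUP_upper bounded_imp_bdd_above compact_imp_bounded)
  have attained: "\<exists>t\<in>topspace K. s x = g (x, t)" if x: "x \<in> topspace X" for x
  proof -
    obtain t where t: "t \<in> topspace K" "\<And>t'. t' \<in> topspace K \<Longrightarrow> g (x, t') \<le> g (x, t)"
      using compact_attains_sup [OF compact [OF x]] K by auto
    then have "s x = g (x, t)"
      unfolding s_def by (intro cSup_eq_maximum) auto
    with t show ?thesis
      by blast
  qed
  have "openin X {x \<in> topspace X. s x > a}" for a
  proof -
    \<comment> \<open>The set where \<open>s\<close> exceeds \<open>a\<close> is the projection to
      \<open>X\<close> of the set where \<open>g\<close> exceeds \<open>a\<close>.\<close>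
    have "openin (prod_topology X K) {z \<in> topspace (prod_topology X K). g z \<in> {a<..}}"
      using g by (rule openin_continuous_map_preimage) auto
    then have "openin X (fst ` {z \<in> topspace (prod_topology X K). g z \<in> {a<..}})"
      using open_map_fst unfolding open_map_def by blast
    moreover have "fst ` {z \<in> topspace (prod_topology X K). g z \<in> {a<..}} = {x \<in> topspace X. s x > a}"
    proof (intro equalityI subsetI)
      fix x
      assume "x \<in> {x \<in> topspace X. s x > a}"
      moreover from this obtain t where "t \<in> topspace K" "s x = g (x, t)"
        using attained by blast
      ultimately show "x \<in> fst ` {z \<in> topspace (prod_topology X K). g z \<in> {a<..}}"
        by (intro image_eqI [of _ _ "(x, t)"]) auto
    next
      fix x
      assume "x \<in> fst ` {z \<in> topspace (prod_topology X K). g z \<in> {a<..}}"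
      then obtain t where "x \<in> topspace X" "t \<in> topspace K" "a < g (x, t)"
        by auto
      then show "x \<in> {x \<in> topspace X. s x > a}"
        using upper [of x t] by simp
    qed
    ultimately show ?thesis
      by simp
  qed
  moreover have "openin X {x \<in> topspace X. s x < a}" for a
  proof (subst openin_subopen, clarify)
    fix x
    assume x: "x \<in> topspace X" "s x < a"
    have W: "openin (prod_topology X K) {z \<in> topspace (prod_topology X K). g z \<in> {..<a}}"
      using g by (rule openin_continuous_map_preimage) auto
    moreover have "{x} \<times> topspace K \<subseteq> {z \<in> topspace (prod_topology X K). g z \<in> {..<a}}"
      using x upper [OF x(1)] by (auto intro: le_less_trans)
    ultimately obtain U V where U: "openin X U" "x \<in> U" "topspace K \<subseteq> V"
        "U \<times> V \<subseteq> {z \<in> topspace (prod_topology X K). g z \<in> {..<a}}"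
      using tube_lemma_right [of X K _ "topspace K" x] x(1) K(1)
      unfolding compact_space_def by metis
    have "U \<subseteq> {x \<in> topspace X. s x < a}"
    proof
      fix y
      assume y: "y \<in> U"
      then have "y \<in> topspace X"
        using U(1) openin_subset by blast
      then obtain t where "t \<in> topspace K" "s y = g (y, t)"
        using attained by blast
      with y U \<open>y \<in> topspace X\<close> show "y \<in> {x \<in> topspace X. s x < a}"
        by auto
    qed
    then show "\<exists>T. openin X T \<and> x \<in> T \<and> T \<subseteq> {x \<in> topspace X. s x < a}"
      using U by blast
  qed
  ultimately show ?thesis
    by (simp add: continuous_map_upper_lower_semicontinuous_lt s_def [abs_def])
qed

section \<open>Strom structures and closed cofibrations\<close>

text \<open>The inequality \<open>u x \<le> t\<close> is weak, so \<open>H\<close> has reached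
  \<open>S\<close> at the very time \<open>u x\<close>; both the gluing of homotopies and the
  stopping of a lift happen at that instant. Values of \<open>u\<close> above 1 are allowed and
  impose nothing on where \<open>H\<close> ends. For a k-space \<open>X\<close> the ordinary product
  with the interval is already the k-ified one.\<close>

definition strom_structure ::
    "'a topology \<Rightarrow> 'a set \<Rightarrow> ('a \<Rightarrow> real) \<Rightarrow> ('a \<times> real \<Rightarrow> 'a) \<Rightarrow> bool" where
  "strom_structure X S u H \<longleftrightarrow>
     continuous_map X euclideanreal u \<and>
     continuous_map (prod_topology X unit_interval) X H \<and>
     (\<forall>x \<in> topspace X. 0 \<le> u x) \<and>
     S = {x \<in> topspace X. u x = 0} \<and>
     (\<forall>x \<in> topspace X. H (x, 0) = x) \<and>
     (\<forall>x \<in> S. \<forall>t \<in> {0..1}. H (x, t) = x) \<and>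
     (\<forall>x \<in> topspace X. \<forall>t \<in> {0..1}. u x \<le> t \<longrightarrow> H (x, t) \<in> S)"

lemma closedin_strom_structure:
  assumes "strom_structure X S u H"
  shows "closedin X S"
proof -
  have "S = {x \<in> topspace X. u x \<in> {0}}" "continuous_map X euclideanreal u"
    using assms by (auto simp: strom_structure_def)
  then show ?thesis
    using closedin_continuous_map_preimage [of X euclideanreal u "{0}"] by simp
qed

text \<open>The extension property yields a retraction \<open>r\<close> of the cylinder
  \<open>P\<close> onto \<open>T\<close>. The first coordinate of \<open>r\<close> is the homotopy;
  the function comes from how far the second coordinate lags behind \<open>t\<close>.\<close>

lemma closed_cofibration_imp_strom_structure:
  fixes A X :: "'a topology"
  assumes "closed_cofibration A X"
  obtains u H where "strom_structure X (topspace A) u H"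
proof -
  have X: "kspace X" and S: "closedin X (topspace A)" and "A = k_subspace X (topspace A)"
    using assms by (auto simp: closed_cofibration_def)
  then have A: "A = subtopology X (topspace A)"
    using k_subspace_closedin by metis
  define S where "S = topspace A"
  have SX: "S \<subseteq> topspace X" and clS: "closedin X S"
    using S closedin_subset S_def by auto
  have kA: "kspace A"
    using A S k_subspace_closedin [OF X S] kspace_k_subspace by metis
  define P where "P = prod_topology X unit_interval"
  have P: "kspace P"
    unfolding P_def using X
    by (intro kspace_prod_compact) (auto simp: compact_space_subtopology Hausdorff_space_subtopology)
  \<comment> \<open>\<open>T\<close> is the mapping cylinder of the inclusion of \<open>S\<close>.
    Being closed in \<open>P\<close> it is a k-space, hence an admissible target; the tautological
    maps of \<open>X\<close> and of the cylinder on \<open>A\<close> into it extend to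
    \<open>r\<close>.\<close>
  define T where "T = topspace X \<times> {0} \<union> S \<times> {0..1::real}"
  have "closedin P T"
    unfolding T_def P_def using clS
    by (intro closedin_Un) (auto simp: closedin_prod_Times_iff closedin_subtopology_alt closed_subset)
  then have E: "kspace (subtopology P T)"
    using k_subspace_closedin [OF P] kspace_k_subspace by metis
  have "continuous_map X (subtopology P T) (\<lambda>x. (x, 0))"
    by (auto simp: P_def T_def continuous_map_in_subtopology continuous_map_pairwise o_def)
  moreover have "continuous_map (k_prod A unit_interval) (subtopology P T) (\<lambda>z. z)"
  proof -
    have "continuous_map A X (\<lambda>x. x)"
      using continuous_map_from_subtopology [OF continuous_map_id, of X S] A
      by (simp add: S_def id_def)
    then have "continuous_map (prod_topology A unit_interval) P (\<lambda>z. z)"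
      unfolding P_def continuous_map_pairwise
      by (auto simp: o_def continuous_map_snd intro: continuous_map_compose [OF continuous_map_fst, unfolded o_def])
    then show ?thesis
      unfolding k_prod_unit_interval [OF kA]
      by (auto simp: continuous_map_in_subtopology T_def S_def)
  qed
  ultimately obtain r where r: "continuous_map (k_prod X unit_interval) (subtopology P T) r"
    and r0: "\<And>x. x \<in> topspace X \<Longrightarrow> r (x, 0) = (x, 0)"
    and rA: "\<And>a t. a \<in> topspace A \<Longrightarrow> t \<in> {0..1} \<Longrightarrow> r (a, t) = (a, t)"
    using closed_cofibration_extend [OF assms E] by (metis (no_types, lifting))
  have rP: "continuous_map P P r" and rT: "\<And>z. z \<in> topspace X \<times> {0..1} \<Longrightarrow> r z \<in> T"
    using r k_prod_unit_interval [OF X] by (auto simp: continuous_map_in_subtopology P_def)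
  define H where "H = (\<lambda>z. fst (r z))"
  \<comment> \<open>\<open>s x\<close> is the greatest lag. If it is less than \<open>t\<close>,
    then \<open>r (x, t)\<close> has positive height, and points of \<open>T\<close> of positive
    height lie over \<open>S\<close>.\<close>
  define s where "s x = (SUP t\<in>{0..1}. t - snd (r (x, t)))" for x
  have H: "continuous_map P X H"
    using continuous_map_compose [OF rP [unfolded P_def] continuous_map_fst] by (simp add: H_def P_def o_def)
  have snd_r: "continuous_map P euclideanreal (\<lambda>z. snd (r z))"
    using continuous_map_compose [OF rP [unfolded P_def] continuous_map_snd]
    by (auto simp: P_def o_def continuous_map_in_subtopology)
  have "continuous_map P euclideanreal (\<lambda>z. snd z - snd (r z))"
    unfolding P_def
    by (intro continuous_map_diff snd_r [unfolded P_def]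
        continuous_map_into_fulltopology [OF continuous_map_snd])
  from continuous_map_Sup_compact [OF this [unfolded P_def]]
  have s: "continuous_map X euclideanreal s"
    by (simp add: s_def [abs_def] compact_space_subtopology)
  have r01: "0 \<le> snd (r (x, t))" if "x \<in> topspace X" "t \<in> {0..1}" for x t
    using rT [of "(x, t)"] that by (auto simp: T_def)
  have upper: "t - snd (r (x, t)) \<le> s x" if "x \<in> topspace X" "t \<in> {0..1}" for x t
    unfolding s_def
  proof (rule cSUP_upper [OF that(2)])
    show "bdd_above ((\<lambda>t. t - snd (r (x, t))) ` {0..1})"
      by (rule bdd_aboveI [of _ 1]) (use r01 [OF that(1)] in fastforce)
  qed
  have s0: "0 \<le> s x" if "x \<in> topspace X" for x
    using upper [OF that, of 0] r0 [OF that] by simp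
  have sS: "s x = 0" if "x \<in> S" for x
    using rA that unfolding s_def S_def by simp
  have HS: "H (x, t) \<in> S" if "x \<in> topspace X" "t \<in> {0..1}" "s x < t" for x t
    using upper [OF that(1,2)] rT [of "(x, t)"] that by (auto simp: H_def T_def)
  \<comment> \<open>With no lag, \<open>H (x, t)\<close> lies in \<open>S\<close> at all times in
    the open interval; as \<open>S\<close> is closed, so does the limit
    \<open>H (x, 0) = x\<close>.\<close>
  have zero: "x \<in> S" if x: "x \<in> topspace X" "s x = 0" for x
  proof -
    define D where "D = {t \<in> topspace unit_interval. H (x, t) \<in> S}"
    have "continuous_map unit_interval P (\<lambda>t. (x, t))"
      using x by (simp add: P_def continuous_map_pairwise o_def)
    then have "continuous_map unit_interval X (\<lambda>t. H (x, t))"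
      using continuous_map_compose [OF _ H] by (fastforce simp: o_def)
    then have "closedin unit_interval D"
      unfolding D_def using clS by (rule closedin_continuous_map_preimage)
    then have "closed D"
      by (simp add: closedin_closed_eq)
    moreover have "{0<..<1} \<subseteq> D"
      using HS x by (auto simp: D_def)
    ultimately have "closure {0<..<1::real} \<subseteq> D"
      by (rule closure_minimal [rotated])
    moreover have "0 \<in> closure {0<..<1::real}"
      by simp
    ultimately have "H (x, 0) \<in> S"
      unfolding D_def by blast
    then show ?thesis
      using r0 x by (simp add: H_def)
  qed
  \<comment> \<open>The factor 2 turns the strict inequality in \<open>HS\<close> into a weak one.\<close>
  have "strom_structure X S (\<lambda>x. 2 * s x) H"
    unfolding strom_structure_def
  proof (intro conjI ballI impI)
    show "continuous_map X euclideanreal (\<lambda>x. 2 * s x)"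
      using s by (intro continuous_map_real_mult) auto
    show "continuous_map (prod_topology X unit_interval) X H"
      using H by (simp add: P_def)
    show "S = {x \<in> topspace X. 2 * s x = 0}"
      using zero sS SX by auto
    show "H (x, t) = x" if "x \<in> S" "t \<in> {0..1}" for x t
      using rA that by (simp add: H_def S_def)
    show "H (x, t) \<in> S" if "x \<in> topspace X" "t \<in> {0..1}" "2 * s x \<le> t" for x t
    proof (cases "s x = 0")
      case True
      then show ?thesis
        using that zero rA by (simp add: H_def S_def)
    next
      case False
      then show ?thesis
        using that s0 [of x] by (intro HS) auto
    qed
  qed (use s0 r0 in \<open>auto simp: H_def\<close>)
  then show thesis
    using that by (simp add: S_def)
qed

text \<open>An extension is obtained by following \<open>H\<close> until it reaches \<open>S\<close>
  and spending the remaining time on the given homotopy \<open>h\<close>.\<close>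

lemma strom_structure_imp_closed_cofibration:
  fixes X :: "'a topology"
  assumes X: "kspace X" and st: "strom_structure X S u H"
  shows "closed_cofibration (k_subspace X S) X"
proof -
  have clS: "closedin X S"
    using st by (rule closedin_strom_structure)
  have SX: "S \<subseteq> topspace X"
    using clS closedin_subset by blast
  have topS: "topspace (k_subspace X S) = S"
    using SX by auto
  have kS: "k_subspace X S = subtopology X S"
    using X clS by (rule k_subspace_closedin)
  have u: "continuous_map X euclideanreal u" and H: "continuous_map (prod_topology X unit_interval) X H"
    and u0: "\<And>x. x \<in> topspace X \<Longrightarrow> 0 \<le> u x" and S: "S = {x \<in> topspace X. u x = 0}"
    and H0: "\<And>x. x \<in> topspace X \<Longrightarrow> H (x, 0) = x"
    and HS: "\<And>x t. x \<in> S \<Longrightarrow> t \<in> {0..1} \<Longrightarrow> H (x, t) = x"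
    and Hu: "\<And>x t. x \<in> topspace X \<Longrightarrow> t \<in> {0..1} \<Longrightarrow> u x \<le> t \<Longrightarrow> H (x, t) \<in> S"
    using st unfolding strom_structure_def by blast+
  define P where "P = prod_topology X unit_interval"
  have HP: "continuous_map P X H"
    using H by (simp add: P_def)
  have sndP: "continuous_map P euclideanreal snd"
    unfolding P_def by (rule continuous_map_into_fulltopology [OF continuous_map_snd])
  have uP: "continuous_map P euclideanreal (\<lambda>z. u (fst z))"
    using continuous_map_compose [OF continuous_map_fst u] by (simp add: P_def o_def)
  have "\<exists>F. continuous_map (k_prod X unit_interval) E F \<and> (\<forall>x \<in> topspace X. F (x, 0) = f x) \<and>
      (\<forall>a \<in> S. \<forall>t \<in> {0..1}. F (a, t) = h (a, t))"
    if f: "continuous_map X E f" and h: "continuous_map (k_prod (k_subspace X S) unit_interval) E h"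
      and h0: "\<forall>a \<in> S. h (a, 0) = f a" for E :: "('a \<times> real) topology" and f h
  proof (intro exI conjI ballI)
    \<comment> \<open>At \<open>t = u x\<close> the point \<open>H (x, t)\<close> is in
      \<open>S\<close>, where \<open>h\<close> starts as \<open>f\<close>, so the branches agree. On
      \<open>S\<close> the waiting time is 0 and \<open>H\<close> is stationary, so \<open>F\<close>
      is \<open>h\<close> there.\<close>
    define F where "F = (\<lambda>z. if snd z \<le> u (fst z) then f (H z) else h (H z, snd z - u (fst z)))"
    have "continuous_map P E F"
      unfolding F_def
    proof (rule continuous_map_cases_le [OF sndP uP])
      show "continuous_map (subtopology P {z. z \<in> topspace P \<and> snd z \<le> u (fst z)}) E (\<lambda>z. f (H z))"
        using continuous_map_compose [OF HP f] by (auto simp: o_def intro: continuous_map_from_subtopology)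
      define Q where "Q = subtopology P {z. z \<in> topspace P \<and> u (fst z) \<le> snd z}"
      have "continuous_map Q (subtopology X S) H"
        using HP Hu by (auto simp: Q_def P_def continuous_map_in_subtopology continuous_map_from_subtopology)
      moreover have "continuous_map Q euclideanreal (\<lambda>z. snd z - u (fst z))"
        unfolding Q_def by (intro continuous_map_from_subtopology continuous_map_diff sndP uP)
      then have "continuous_map Q unit_interval (\<lambda>z. snd z - u (fst z))"
        using u0 by (force simp: Q_def P_def continuous_map_in_subtopology)
      ultimately have "continuous_map Q (prod_topology (subtopology X S) unit_interval)
          (\<lambda>z. (H z, snd z - u (fst z)))"
        by (simp add: continuous_map_pairwise o_def)
      moreover have "continuous_map (prod_topology (subtopology X S) unit_interval) E h"
        using h k_prod_unit_interval [OF kspace_k_subspace, of X S] kS by simp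
      ultimately show "continuous_map Q E (\<lambda>z. h (H z, snd z - u (fst z)))"
        using continuous_map_compose by (fastforce simp: o_def)
      show "f (H z) = h (H z, snd z - u (fst z))" if "z \<in> topspace P" "snd z = u (fst z)" for z
        using that h0 Hu [of "fst z" "snd z"] by (auto simp: P_def)
    qed
    then show "continuous_map (k_prod X unit_interval) E F"
      by (simp add: k_prod_unit_interval [OF X] P_def)
    show "F (x, 0) = f x" if "x \<in> topspace X" for x
      using that u0 H0 by (simp add: F_def)
    show "F (a, t) = h (a, t)" if "a \<in> S" "t \<in> {0..1}" for a t
    proof -
      have "u a = 0"
        using that S by blast
      then show ?thesis
        using that HS h0 by (auto simp: F_def)
    qed
  qed
  then show ?thesis
    unfolding closed_cofibration_def topS using X clS by blast
qed

section \<open>Lifting a Strom structure along a fibration\<close>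

lemma strom_structure_lift:
  fixes B :: "'b topology" and Y :: "'y topology"
  assumes q: "hurewicz_fibration Y B q" and st: "strom_structure B S u H"
  obtains K where "strom_structure Y {y \<in> topspace Y. q y \<in> S} (u \<circ> q) K"
proof -
  have Y: "kspace Y" and contq: "continuous_map Y B q"
    using q by (auto simp: hurewicz_fibration_def)
  have qB: "\<And>y. y \<in> topspace Y \<Longrightarrow> q y \<in> topspace B"
    using contq by (auto simp: continuous_map_def)
  have u: "continuous_map B euclideanreal u" and H: "continuous_map (prod_topology B unit_interval) B H"
    and u0: "\<And>x. x \<in> topspace B \<Longrightarrow> 0 \<le> u x" and S: "S = {x \<in> topspace B. u x = 0}"
    and H0: "\<And>x. x \<in> topspace B \<Longrightarrow> H (x, 0) = x"
    and Hu: "\<And>x t. x \<in> topspace B \<Longrightarrow> t \<in> {0..1} \<Longrightarrow> u x \<le> t \<Longrightarrow> H (x, t) \<in> S"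
    using st unfolding strom_structure_def by blast+
  define P where "P = prod_topology Y unit_interval"
  have kP: "k_prod Y unit_interval = P"
    by (simp add: P_def k_prod_unit_interval [OF Y])
  have "continuous_map P (prod_topology B unit_interval) (\<lambda>z. (q (fst z), snd z))"
    using continuous_map_compose [OF continuous_map_fst contq]
    by (simp add: P_def continuous_map_pairwise o_def continuous_map_snd)
  then have "continuous_map (k_prod Y unit_interval) B (\<lambda>z. H (q (fst z), snd z))"
    unfolding kP using continuous_map_compose [OF _ H] by (fastforce simp: o_def)
  then obtain L where L: "continuous_map P Y L"
    and L0: "\<And>y. y \<in> topspace Y \<Longrightarrow> L (y, 0) = y"
    and qL: "\<And>y t. y \<in> topspace Y \<Longrightarrow> t \<in> {0..1} \<Longrightarrow> q (L (y, t)) = H (q y, t)"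
    using hurewicz_fibration_lift [OF q Y continuous_map_id, of "\<lambda>z. H (q (fst z), snd z)"] H0 qB
    unfolding kP by auto
  define K where "K = (\<lambda>z. L (fst z, min (snd z) (u (q (fst z)))))"
  have uq: "continuous_map Y euclideanreal (u \<circ> q)"
    using contq u by (rule continuous_map_compose)
  have "strom_structure Y {y \<in> topspace Y. q y \<in> S} (u \<circ> q) K"
    unfolding strom_structure_def
  proof (intro conjI ballI impI)
    show "continuous_map Y euclideanreal (u \<circ> q)"
      by (rule uq)
    have "continuous_map P euclideanreal (\<lambda>z. min (snd z) (u (q (fst z))))"
    proof (rule continuous_map_real_min)
      show "continuous_map P euclideanreal snd"
        unfolding P_def by (rule continuous_map_into_fulltopology [OF continuous_map_snd])
      show "continuous_map P euclideanreal (\<lambda>z. u (q (fst z)))"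
        using continuous_map_compose [OF continuous_map_fst uq] by (simp add: P_def o_def)
    qed
    \<comment> \<open>The stopped time stays in the interval: it is nonnegative because
      \<open>u\<close> is, and at most \<open>snd z\<close>.\<close>
    then have "continuous_map P unit_interval (\<lambda>z. min (snd z) (u (q (fst z))))"
      using u0 qB by (auto simp: P_def continuous_map_in_subtopology min_le_iff_disj)
    then have "continuous_map P P (\<lambda>z. (fst z, min (snd z) (u (q (fst z)))))"
      by (simp add: P_def continuous_map_pairwise o_def continuous_map_fst)
    from continuous_map_compose [OF this L] show "continuous_map (prod_topology Y unit_interval) Y K"
      by (simp add: K_def P_def o_def)
    show "{y \<in> topspace Y. q y \<in> S} = {y \<in> topspace Y. (u \<circ> q) y = 0}"
      using S qB by auto
    show "0 \<le> (u \<circ> q) y" if "y \<in> topspace Y" for y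
      using that u0 qB by simp
    show "K (y, 0) = y" if "y \<in> topspace Y" for y
      using that L0 u0 qB by (simp add: K_def min_def)
    show "K (y, t) = y" if "y \<in> {y \<in> topspace Y. q y \<in> S}" "t \<in> {0..1}" for y t
      using that L0 S by (auto simp: K_def min_def)
    show "K (y, t) \<in> {y \<in> topspace Y. q y \<in> S}"
      if y: "y \<in> topspace Y" and t: "t \<in> {0..1}" "(u \<circ> q) y \<le> t" for y t
    proof -
      \<comment> \<open>From \<open>u (q y) \<le> t \<le> 1\<close>, the stopping time is one at
        which \<open>L\<close> is defined and covers \<open>H\<close>.\<close>
      have uqy: "u (q y) \<in> {0..1}"
        using u0 [OF qB [OF y]] t by auto
      then have "L (y, u (q y)) \<in> topspace Y"
        using L y by (auto simp: P_def continuous_map_def Pi_iff)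
      moreover have "q (L (y, u (q y))) \<in> S"
        using qL [OF y uqy] Hu [OF qB [OF y] uqy] by simp
      moreover have "K (y, t) = L (y, u (q y))"
        using t by (simp add: K_def min_def)
      ultimately show ?thesis
        by simp
    qed
  qed
  then show thesis
    by (rule that)
qed

theorem theorem15:
  fixes A B :: "'b topology" and Y :: "'y topology" and q :: "'y \<Rightarrow> 'b"
  assumes "kspace A" and "kspace B" and "kspace Y"
    and "weak_Hausdorff B"
    and "hurewicz_fibration Y B q"
    and "closed_cofibration A B"
  shows "closed_cofibration (restrict_over Y q A) Y"
proof -
  obtain u H where "strom_structure B (topspace A) u H"
    using assms(6) by (rule closed_cofibration_imp_strom_structure)
  then obtain K where "strom_structure Y {y \<in> topspace Y. q y \<in> topspace A} (u \<circ> q) K"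
    by (rule strom_structure_lift [OF assms(5)])
  then show ?thesis
    unfolding restrict_over_def by (rule strom_structure_imp_closed_cofibration [OF assms(3)])
qed

end
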